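(* Let $n\geq 3$ be an integer. Then $\chi(\mathcal{M}(K_{2n}))\leq \chi(\mathrm{SR}_{n-1})+\chi(\mathrm{SR}_{n-2})$.
   Context: $K_{2n}$ is the complete graph on $2n$ vertices. The flip graph $\mathcal{M}(K_{2n})$ is the graph whose vertices are the perfect matchings of $K_{2n}$, where two perfect matchings are adjacent if their symmetric difference (as edge sets) is a cycle of length $4$. For $k\geq 1$, a signed permutation of degree $k$ is a $k$-tuple $(\sigma_1,\dots,\sigma_k)$ of integers such that $(|\sigma_1|,\dots,|\sigma_k|)$ is a permutation of $\{1,\dots,k\}$. The signed reversal graph $\mathrm{SR}_k$ is the graph whose vertices are the signed permutations of degree $k$, where $\sigma=(\sigma_1,\dots,\sigma_k)$ and $\tau=(\tau_1,\dots,\tau_k)$ are adjacent if there exist $1\leq i\leq j\leq k$ such that $(\tau_1,\dots,\tau_k)=(\sigma_1,\dots,\sigma_{i-1},-\sigma_j,-\sigma_{j-1},\dots,-\sigma_i,\sigma_{j+1},\dots,\sigma_k)$. $\chi(G)$ denotes the chromatic number of a graph $G$. *)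

theory Defs
  imports "Graph_Theory.Graph_Theory" "HOL-Combinatorics.Multiset_Permutations"
begin

text \<open>
  Finite simple graphs are the \<open>pair_graph\<close>s of the Graph Theory library: an undirected edge
  is represented by its two arcs. The lemmas below show that all graphs defined here are of this
  kind.
\<close>

text \<open>
  On natural numbers \<open>LEAST\<close> is only meaningful if some proper colouring with finitely many
  colours exists, as is the case for every \<open>pair_graph\<close> (lemma \<open>chromatic_number_attained\<close>).
\<close>

definition proper_colouring :: "'a pair_pre_digraph \<Rightarrow> nat \<Rightarrow> ('a \<Rightarrow> nat) \<Rightarrow> bool" where
  "proper_colouring G k c \<longleftrightarrow>
     (\<forall>v \<in> pverts G. c v < k) \<and> (\<forall>(u, v) \<in> parcs G. c u \<noteq> c v)"

definition chromatic_number :: "'a pair_pre_digraph \<Rightarrow> nat" where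
  "chromatic_number G = (LEAST k. \<exists>c. proper_colouring G k c)"

definition undirected_edges :: "'a pair_pre_digraph \<Rightarrow> 'a set set" where
  "undirected_edges G = {{u, v} | u v. (u, v) \<in> parcs G}"

definition perfect_matching :: "'a pair_pre_digraph \<Rightarrow> 'a set set \<Rightarrow> bool" where
  "perfect_matching G M \<longleftrightarrow> M \<subseteq> undirected_edges G \<and> (\<forall>v \<in> pverts G. \<exists>!e. e \<in> M \<and> v \<in> e)"

definition is_four_cycle :: "'a set set \<Rightarrow> bool" where
  "is_four_cycle C \<longleftrightarrow>
     (\<exists>a b c d. distinct [a, b, c, d] \<and> C = {{a, b}, {b, c}, {c, d}, {d, a}})"

definition flip_graph :: "'a pair_pre_digraph \<Rightarrow> 'a set set pair_pre_digraph" where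
  "flip_graph G = \<lparr>
     pverts = {M. perfect_matching G M},
     parcs = {(M, N). perfect_matching G M \<and> perfect_matching G N \<and>
                      is_four_cycle (sym_diff M N)} \<rparr>"

definition complete_graph :: "nat \<Rightarrow> nat pair_pre_digraph" where
  "complete_graph m = \<lparr>
     pverts = {1..m},
     parcs = {(u, v). u \<in> {1..m} \<and> v \<in> {1..m} \<and> u \<noteq> v} \<rparr>"

definition signed_permutations :: "nat \<Rightarrow> int list set" where
  "signed_permutations k = {\<sigma>. map abs \<sigma> \<in> permutations_of_set {1..int k}}"

text \<open>The positions \<open>i \<le> j\<close> are counted from 1, whereas list indices start at 0.\<close>

definition signed_reversal :: "nat \<Rightarrow> nat \<Rightarrow> int list \<Rightarrow> int list" where
  "signed_reversal i j \<sigma> =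
     take (i - 1) \<sigma> @ map uminus (rev (drop (i - 1) (take j \<sigma>))) @ drop j \<sigma>"

definition signed_reversal_graph :: "nat \<Rightarrow> int list pair_pre_digraph" where
  "signed_reversal_graph k = \<lparr>
     pverts = signed_permutations k,
     parcs = {(\<sigma>, \<tau>). \<sigma> \<in> signed_permutations k \<and> \<tau> \<in> signed_permutations k \<and>
                      (\<exists>i j. 1 \<le> i \<and> i \<le> j \<and> j \<le> k \<and> \<tau> = signed_reversal i j \<sigma>)} \<rparr>"

lemma chromatic_number_attained:
  assumes "pair_graph G"
  shows "\<exists>c. proper_colouring G (chromatic_number G) c"
proof -
  interpret pair_graph G by fact
  obtain c where c: "bij_betw c (pverts G) {0..<card (pverts G)}"
    using ex_bij_betw_finite_nat[OF pair_finite_verts] by blast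
  have "c v < card (pverts G)" if "v \<in> pverts G" for v
    using bij_betwE[OF c] that by auto
  moreover have "c u \<noteq> c v" if "(u, v) \<in> parcs G" for u v
  proof -
    have "u \<in> pverts G" "v \<in> pverts G" "u \<noteq> v"
      using in_arcsD1[OF that] in_arcsD2[OF that] pair_no_loops[OF that] by auto
    then show ?thesis using c by (auto simp: bij_betw_def inj_on_def)
  qed
  ultimately have "proper_colouring G (card (pverts G)) c"
    by (auto simp: proper_colouring_def)
  then have "\<exists>c. proper_colouring G (card (pverts G)) c" by blast
  then show ?thesis
    unfolding chromatic_number_def by (rule LeastI)
qed

lemma pair_graphI:
  assumes "finite (pverts G)" "parcs G \<subseteq> pverts G \<times> pverts G"
    "\<And>u. (u, u) \<notin> parcs G" "sym (parcs G)"
  shows "pair_graph G"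
proof -
  have "finite (parcs G)" using assms(1,2) by (meson finite_SigmaI finite_subset)
  then show ?thesis using assms
    by unfold_locales (auto simp: symmetric_def)
qed

lemma complete_graph: "K\<^bsub>m\<^esub> (with_proj (complete_graph m))"
  unfolding complete_digraph_pair_def by (auto simp: complete_graph_def)

lemma pair_graph_flip_graph:
  assumes "pair_graph G"
  shows "pair_graph (flip_graph G)"
proof (rule pair_graphI)
  interpret pair_graph G by fact
  have "undirected_edges G \<subseteq> Pow (pverts G)"
    by (auto simp: undirected_edges_def dest: in_arcsD1 in_arcsD2)
  then have "finite (undirected_edges G)"
    using pair_finite_verts by (meson finite_Pow_iff finite_subset)
  moreover have "pverts (flip_graph G) \<subseteq> Pow (undirected_edges G)"
    by (auto simp: flip_graph_def perfect_matching_def)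
  ultimately show "finite (pverts (flip_graph G))"
    by (meson finite_Pow_iff finite_subset)
  show "parcs (flip_graph G) \<subseteq> pverts (flip_graph G) \<times> pverts (flip_graph G)"
    by (auto simp: flip_graph_def)
  show "(M, M) \<notin> parcs (flip_graph G)" for M
    by (simp add: flip_graph_def is_four_cycle_def)
  show "sym (parcs (flip_graph G))"
    by (rule symI) (simp add: flip_graph_def Un_commute)
qed

lemma length_signed_permutations:
  assumes "\<sigma> \<in> signed_permutations k"
  shows "length \<sigma> = k"
proof -
  have "length (map abs \<sigma>) = card {1..int k}"
    using assms unfolding signed_permutations_def permutations_of_set_def
    by (metis (mono_tags, lifting) distinct_card mem_Collect_eq)
  then show ?thesis by simp
qed

lemma signed_reversal_involution:
  assumes "1 \<le> i" "i \<le> j" "j \<le> length \<sigma>"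
  shows "signed_reversal i j (signed_reversal i j \<sigma>) = \<sigma>"
proof -
  define xs ys zs where "xs = take (i - 1) \<sigma>" and "ys = drop (i - 1) (take j \<sigma>)" and "zs = drop j \<sigma>"
  have len: "length xs = i - 1" "length ys = j - (i - 1)"
    using assms by (auto simp: xs_def ys_def)
  have "take (i - 1) (take j \<sigma>) = xs" using assms by (simp add: xs_def)
  then have "xs @ ys = take j \<sigma>" by (metis ys_def append_take_drop_id)
  then have "\<sigma> = xs @ ys @ zs" by (metis append_take_drop_id append.assoc zs_def)
  moreover have "signed_reversal i j (xs @ us @ zs) = xs @ map uminus (rev us) @ zs"
    if "length us = length ys" for us
    using that len assms by (simp add: signed_reversal_def)
  ultimately show ?thesis
    by (simp add: rev_map comp_def)
qed

lemma signed_reversal_neq: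
  assumes "\<sigma> \<in> signed_permutations k" "1 \<le> i" "i \<le> j" "j \<le> k"
  shows "signed_reversal i j \<sigma> \<noteq> \<sigma>"
proof
  assume eq: "signed_reversal i j \<sigma> = \<sigma>"
  have len: "length \<sigma> = k" using assms by (simp add: length_signed_permutations)
  have "signed_reversal i j \<sigma> ! (i - 1) = - \<sigma> ! (j - 1)"
    using assms len by (simp add: signed_reversal_def nth_append rev_nth)
  then have neg: "\<sigma> ! (i - 1) = - \<sigma> ! (j - 1)" using eq by simp
  have "distinct (map abs \<sigma>)" and set: "set (map abs \<sigma>) = {1..int k}"
    using assms(1) by (auto simp: signed_permutations_def permutations_of_set_def)
  moreover have "map abs \<sigma> ! (i - 1) = map abs \<sigma> ! (j - 1)"
    using neg len assms by simp
  ultimately have "i - 1 = j - 1"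
    using len assms nth_eq_iff_index_eq[of "map abs \<sigma>" "i - 1" "j - 1"] by simp
  then have "\<sigma> ! (j - 1) = 0" using neg by simp
  moreover have "\<bar>\<sigma> ! (j - 1)\<bar> \<in> set (map abs \<sigma>)" using len assms by simp
  ultimately show False unfolding set by simp
qed

lemma pair_graph_signed_reversal_graph: "pair_graph (signed_reversal_graph k)"
proof (rule pair_graphI)
  have "signed_permutations k \<subseteq> {\<sigma>. set \<sigma> \<subseteq> {- int k..int k} \<and> length \<sigma> = k}"
  proof (intro subsetI CollectI conjI)
    fix \<sigma> x assume "\<sigma> \<in> signed_permutations k" "x \<in> set \<sigma>"
    then have "\<bar>x\<bar> \<in> {1..int k}"
      unfolding signed_permutations_def permutations_of_set_def by fastforce
    then show "x \<in> {- int k..int k}" by auto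
  qed (simp add: length_signed_permutations)
  then show "finite (pverts (signed_reversal_graph k))"
    by (simp add: signed_reversal_graph_def finite_lists_length_eq finite_subset)
  show "(\<sigma>, \<sigma>) \<notin> parcs (signed_reversal_graph k)" for \<sigma>
  proof
    assume "(\<sigma>, \<sigma>) \<in> parcs (signed_reversal_graph k)"
    then obtain i j where "\<sigma> \<in> signed_permutations k" "1 \<le> i" "i \<le> j" "j \<le> k"
      "\<sigma> = signed_reversal i j \<sigma>"
      by (auto simp: signed_reversal_graph_def)
    then show False by (metis signed_reversal_neq)
  qed
  show "sym (parcs (signed_reversal_graph k))"
  proof (rule symI)
    fix \<sigma> \<tau> assume "(\<sigma>, \<tau>) \<in> parcs (signed_reversal_graph k)"
    then obtain i j where *: "\<sigma> \<in> signed_permutations k" "\<tau> \<in> signed_permutations k"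
      "1 \<le> i" "i \<le> j" "j \<le> k" "\<tau> = signed_reversal i j \<sigma>"
      by (auto simp: signed_reversal_graph_def)
    then have "\<sigma> = signed_reversal i j \<tau>"
      by (simp add: length_signed_permutations signed_reversal_involution)
    then have "\<exists>i j. 1 \<le> i \<and> i \<le> j \<and> j \<le> k \<and> \<sigma> = signed_reversal i j \<tau>"
      using *(3-5) by blast
    then show "(\<tau>, \<sigma>) \<in> parcs (signed_reversal_graph k)"
      by (simp add: signed_reversal_graph_def *(1,2))
  qed
  show "parcs (signed_reversal_graph k)
          \<subseteq> pverts (signed_reversal_graph k) \<times> pverts (signed_reversal_graph k)"
    unfolding signed_reversal_graph_def by force
qed

end

theory Submission
  imports Defs "HOL-Combinatorics.Cycles"
begin

text \<open>
  Fix a reference perfect matching of the complete graph, and label its edges by \<open>1, \<dots>, n\<close> so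
  that the ends of the edge \<open>i\<close> are \<open>i\<close> and \<open>- i\<close>. The union of any perfect matching \<open>M\<close> with the
  reference matching is a disjoint union of alternating cycles. Listing the reference edges
  along a cycle, each with a sign for the direction in which it is traversed, describes the cycle
  by a signed word. If each cycle starts at its smallest label with positive sign, its
  word is unique (\<open>canonical_cycles\<close>), and \<open>M\<close> becomes a signed permutation \<open>word M\<close> of degree \<open>n\<close>:
  the concatenation of the words of its cycles, ordered by their first letters, the roots.

  A flip replaces two edges of \<open>M\<close>. If they lie on different cycles, these cycles merge. If
  they lie on one cycle, then either the cycle splits in two, or the segment between the
  two edges is traversed backwards (\<open>flip_outcome\<close>). Merging and splitting change the number
  of cycles by one. A flip between matchings whose numbers of cycles have the same parity is
  therefore a signed reversal inside one cycle. It keeps all roots, and it does not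
  move them, so it is also a signed reversal after some of the roots have been deleted from the
  word (\<open>reduced_word_reversal\<close>).

  If the number of cycles is odd, deleting one root leaves a signed permutation of \<open>n - 1\<close>
  labels. If it is even, there are at least two cycles, and deleting two roots leaves
  a signed permutation of \<open>n - 2\<close> labels. Up to relabelling, each of the two parity classes is
  thus mapped to a signed reversal graph by a homomorphism. Pulling back optimal colourings of
  these graphs, with disjoint sets of colours for the two classes, colours the
  flip graph (\<open>signed_matchings_colouring\<close>).
\<close>

section \<open>Alternating cycles as words\<close>

text \<open>
  The signed integer \<open>x\<close> and its opposite \<open>- x\<close> are the two ends of an edge of the reference
  matching. A word \<open>x\<^sub>1, \<dots>, x\<^sub>k\<close> describes the alternating walk that enters the reference edge
  \<open>{- x\<^sub>i, x\<^sub>i}\<close> at \<open>- x\<^sub>i\<close>, leaves it at \<open>x\<^sub>i\<close>, and then uses the edge \<open>{x\<^sub>i, - x\<^sub>j}\<close> of the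
  matching under study, where \<open>j = i + 1\<close>. Walking backwards is \<open>neg_rev\<close>, which is why
  reversing a segment of a word comes with a change of signs.
\<close>
definition neg_rev :: "int list \<Rightarrow> int list" where
  "neg_rev xs = map uminus (rev xs)"

fun path_edges :: "int list \<Rightarrow> int set set" where
  "path_edges [] = {}"
| "path_edges [x] = {}"
| "path_edges (x # y # zs) = insert {x, - y} (path_edges (y # zs))"

definition cycle_edges :: "int list \<Rightarrow> int set set" where
  "cycle_edges xs = insert {last xs, - hd xs} (path_edges xs)"

abbreviation block :: "int list \<Rightarrow> int set" where
  "block xs \<equiv> abs ` set xs"

lemma neg_rev_simps [simp]:
  "neg_rev xs = [] \<longleftrightarrow> xs = []"
  "block (neg_rev xs) = block xs"
  "distinct (map abs (neg_rev xs)) \<longleftrightarrow> distinct (map abs xs)"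
proof -
  have eq: "map abs (neg_rev xs) = rev (map abs xs)"
    by (simp add: neg_rev_def rev_map comp_def)
  show "distinct (map abs (neg_rev xs)) \<longleftrightarrow> distinct (map abs xs)"
    unfolding eq by simp
  show "block (neg_rev xs) = block xs"
    using arg_cong[OF eq, of set] by simp
qed (simp_all add: neg_rev_def rev_map comp_def)

lemma hd_neg_rev: "xs \<noteq> [] \<Longrightarrow> hd (neg_rev xs) = - last xs"
  by (simp add: neg_rev_def hd_map hd_rev)

lemma last_neg_rev: "xs \<noteq> [] \<Longrightarrow> last (neg_rev xs) = - hd xs"
  by (simp add: neg_rev_def last_map last_rev)

lemma path_edges_append:
  assumes "xs \<noteq> []" "ys \<noteq> []"
  shows "path_edges (xs @ ys) = insert {last xs, - hd ys} (path_edges xs \<union> path_edges ys)"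
  using assms
proof (induction xs rule: path_edges.induct)
  case (2 x)
  then show ?case by (cases ys) auto
qed auto

lemma path_edges_neg_rev [simp]: "path_edges (neg_rev xs) = path_edges xs"
proof (induction xs rule: path_edges.induct)
  case (3 x y zs)
  have "neg_rev (x # y # zs) = neg_rev (y # zs) @ [- x]"
    by (simp add: neg_rev_def)
  then show ?case
    using 3 by (simp add: path_edges_append last_neg_rev insert_commute)
qed (auto simp: neg_rev_def)

lemma cycle_edges_rotate: "cycle_edges (xs @ ys) = cycle_edges (ys @ xs)"
  by (cases "xs = [] \<or> ys = []") (auto simp: cycle_edges_def path_edges_append)

lemma path_edges_abs: "e \<in> path_edges xs \<Longrightarrow> x \<in> e \<Longrightarrow> \<bar>x\<bar> \<in> block xs"
  by (induction xs rule: path_edges.induct) auto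

lemma cycle_edges_abs: "e \<in> cycle_edges xs \<Longrightarrow> x \<in> e \<Longrightarrow> xs \<noteq> [] \<Longrightarrow> \<bar>x\<bar> \<in> block xs"
  using path_edges_abs[of e xs x] by (auto simp: cycle_edges_def)

text \<open>
  An edge of a cyclic word sits at the end of a prefix; the prefix that ends at the closing edge
  is the whole word, and this is why \<open>ds\<close> may be empty and \<open>- hd (ds @ as)\<close> is used.
\<close>
lemma cycle_edges_splitE:
  assumes "e \<in> cycle_edges xs" "xs \<noteq> []"
  obtains as ds where "xs = as @ ds" "as \<noteq> []" "e = {last as, - hd (ds @ as)}"
proof -
  have path: "\<exists>as ds. xs = as @ ds \<and> as \<noteq> [] \<and> ds \<noteq> [] \<and> e = {last as, - hd ds}"
    if "e \<in> path_edges xs"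
    using that
  proof (induction xs rule: path_edges.induct)
    case (3 x y zs)
    show ?case
    proof (cases "e = {x, - y}")
      case True
      then show ?thesis by (intro exI[of _ "[x]"] exI[of _ "y # zs"]) simp
    next
      case False
      then obtain as ds where "y # zs = as @ ds" "as \<noteq> []" "ds \<noteq> []" "e = {last as, - hd ds}"
        using 3 by auto
      then show ?thesis by (intro exI[of _ "x # as"] exI[of _ ds]) simp
    qed
  qed auto
  show thesis
  proof (cases "e = {last xs, - hd xs}")
    case True
    then show thesis using that[of xs "[]"] assms by simp
  next
    case False
    then show thesis using path that assms unfolding cycle_edges_def
      by (metis hd_append2 insertE)
  qed
qed

text \<open>
  Two edges cut a cyclic word into the paths \<open>bs\<close> and \<open>ds @ as\<close>. The initial part \<open>as\<close> is
  nonempty, so the first letter of the word never lies in \<open>bs\<close>.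
\<close>
lemma cycle_edges_split2E:
  assumes "e1 \<in> cycle_edges xs" "e2 \<in> cycle_edges xs" "e1 \<noteq> e2" "xs \<noteq> []"
  obtains as bs ds where "xs = as @ bs @ ds" "as \<noteq> []" "bs \<noteq> []"
    "{e1, e2} = {{last as, - hd bs}, {last bs, - hd (ds @ as)}}"
proof -
  have *: "\<exists>as bs ds. xs = as @ bs @ ds \<and> as \<noteq> [] \<and> bs \<noteq> [] \<and>
      {e1, e2} = {{last as, - hd bs}, {last bs, - hd (ds @ as)}}"
    if split: "xs = as @ ds" "as \<noteq> []" "e1 = {last as, - hd (ds @ as)}"
       "xs = cs @ fs" "cs \<noteq> []" "e2 = {last cs, - hd (fs @ cs)}" "length as < length cs"
    for as ds cs fs e1 e2
  proof -
    obtain bs where bs: "cs = as @ bs" "ds = bs @ fs"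
      using split(1,4,7) by (auto simp: append_eq_append_conv2)
    then have "bs \<noteq> []" using split(7) by auto
    have "e1 = {last as, - hd bs}"
      unfolding split(3) bs(2) using \<open>bs \<noteq> []\<close> by simp
    moreover have "hd (fs @ cs) = hd (fs @ as)"
      unfolding bs(1) using split(2) by (cases fs) simp_all
    then have "e2 = {last bs, - hd (fs @ as)}"
      unfolding split(6) using \<open>bs \<noteq> []\<close> bs(1) by simp
    moreover have "xs = as @ bs @ fs" unfolding split(1) bs(2) ..
    ultimately show ?thesis using split(2) \<open>bs \<noteq> []\<close> by blast
  qed
  obtain as ds where s1: "xs = as @ ds" "as \<noteq> []" "e1 = {last as, - hd (ds @ as)}"
    using cycle_edges_splitE assms by metis
  obtain cs fs where s2: "xs = cs @ fs" "cs \<noteq> []" "e2 = {last cs, - hd (fs @ cs)}"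
    using cycle_edges_splitE assms by metis
  have "length as \<noteq> length cs"
  proof
    assume "length as = length cs"
    then have "as = cs" "ds = fs" using s1(1) s2(1) by auto
    then show False using s1(3) s2(3) assms(3) by simp
  qed
  then consider "length as < length cs" | "length cs < length as" by linarith
  then have "\<exists>as bs ds. xs = as @ bs @ ds \<and> as \<noteq> [] \<and> bs \<noteq> [] \<and>
      {e1, e2} = {{last as, - hd bs}, {last bs, - hd (ds @ as)}}"
  proof cases
    case 1
    then show ?thesis using *[OF s1 s2] by simp
  next
    case 2
    then show ?thesis using *[OF s2 s1] by (simp add: insert_commute)
  qed
  then show thesis using that by blast
qed

text \<open>
  The last letter of a path waits for the edge that leads onwards. An edge that contains it is
  thus none of the edges of the path, and removing it leaves the path intact.
\<close>
lemma last_notin_path_edges: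
  assumes "distinct (map abs xs)" "0 \<notin> set xs" "e \<in> path_edges xs"
  shows "last xs \<notin> e"
  using assms
proof (induction xs rule: path_edges.induct)
  case (3 x y zs)
  have "last (y # zs) \<in> set (y # zs)" by simp
  then have "\<bar>last (y # zs)\<bar> \<in> block (y # zs)" by blast
  then have "\<bar>last (y # zs)\<bar> \<noteq> \<bar>x\<bar>" using 3(2) by auto
  moreover have "last (y # zs) \<noteq> - y"
    using 3(2,3) imageI[OF last_in_set[of zs], of abs]
    by (cases "zs = []") (auto simp del: last_in_set)
  moreover have "last (y # zs) \<notin> e" if "e \<in> path_edges (y # zs)"
    using 3 that by simp
  ultimately show ?case using 3(4) by auto
qed auto

lemma cycle_edges_cover:
  assumes "\<bar>x\<bar> \<in> block xs"
  shows "\<exists>e \<in> cycle_edges xs. x \<in> e"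
proof -
  obtain z where z: "z \<in> set xs" "x = z \<or> x = - z" using assms by (auto simp: abs_eq_iff)
  then obtain as ds where xs: "xs = as @ z # ds" by (meson split_list)
  have "cycle_edges xs = cycle_edges ((z # ds) @ as)"
    using xs cycle_edges_rotate[of as "z # ds"] by simp
  moreover have "cycle_edges xs = cycle_edges ((ds @ as) @ [z])"
    using xs cycle_edges_rotate[of "as @ [z]" ds] by simp
  moreover have "\<exists>e \<in> cycle_edges ((z # ds) @ as). - z \<in> e"
    "\<exists>e \<in> cycle_edges ((ds @ as) @ [z]). z \<in> e"
    unfolding cycle_edges_def by simp_all
  ultimately show ?thesis using z(2) by blast
qed

lemma path_edges_map_upt:
  "path_edges (map f [0..<Suc k]) = (\<lambda>i. {f i, - f (Suc i)}) ` {..<k}"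
proof (induction k)
  case (Suc k)
  have "map f [0..<Suc (Suc k)] = map f [0..<Suc k] @ [f (Suc k)]" by simp
  then show ?case
    using Suc by (simp add: path_edges_append lessThan_Suc del: upt_Suc) (simp add: upt_Suc)
qed simp

section \<open>Perfect matchings of the signed points\<close>

locale signed_matching =
  fixes n :: nat and M :: "int set set"
  assumes edgeE: "e \<in> M \<Longrightarrow> \<exists>x y. e = {x, y} \<and> x \<noteq> y \<and> \<bar>x\<bar> \<in> {1..int n} \<and> \<bar>y\<bar> \<in> {1..int n}"
    and edge_ex1: "\<bar>x\<bar> \<in> {1..int n} \<Longrightarrow> \<exists>!e. e \<in> M \<and> x \<in> e"

definition is_cycle :: "int set set \<Rightarrow> int list \<Rightarrow> bool" where
  "is_cycle M xs \<longleftrightarrow> xs \<noteq> [] \<and> distinct (map abs xs) \<and> cycle_edges xs \<subseteq> M"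

context signed_matching begin

lemma edge_range: "{x, y} \<in> M \<Longrightarrow> \<bar>x\<bar> \<in> {1..int n} \<and> \<bar>y\<bar> \<in> {1..int n} \<and> x \<noteq> y"
  using edgeE[of "{x, y}"] by (auto simp: doubleton_eq_iff)

lemma edge_unique: "{x, y} \<in> M \<Longrightarrow> {x, z} \<in> M \<Longrightarrow> y = z"
  using edge_ex1[of x] edge_range[of x y] by (metis doubleton_eq_iff insertI1)

lemma partner_ex: "\<bar>x\<bar> \<in> {1..int n} \<Longrightarrow> \<exists>y. {x, y} \<in> M"
  using edge_ex1[of x] edgeE by (metis empty_iff insertE insert_commute)

lemma cycle_range:
  assumes "is_cycle M xs"
  shows "block xs \<subseteq> {1..int n}"
proof
  fix t assume "t \<in> block xs"
  then obtain x where x: "\<bar>x\<bar> \<in> block xs" "t = \<bar>x\<bar>" by auto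
  then obtain e where "e \<in> M" "x \<in> e"
    using cycle_edges_cover assms unfolding is_cycle_def by (metis subsetD)
  then show "t \<in> {1..int n}" using edgeE[of e] x by auto
qed

lemma cycle_closed:
  assumes "is_cycle M xs" "\<bar>x\<bar> \<in> block xs" "{x, y} \<in> M"
  shows "{x, y} \<in> cycle_edges xs"
proof -
  obtain e where e: "e \<in> cycle_edges xs" "x \<in> e" using cycle_edges_cover assms by blast
  then have "e \<in> M" using assms unfolding is_cycle_def by auto
  moreover have "\<bar>x\<bar> \<in> {1..int n}" using cycle_range assms by blast
  ultimately show ?thesis using e edge_ex1 assms by (metis insertI1)
qed

lemma cycle_rotate: "is_cycle M (xs @ ys) \<Longrightarrow> is_cycle M (ys @ xs)"
  unfolding is_cycle_def by (auto simp: cycle_edges_rotate)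

text \<open>
  Propagation along a path: a set of labels that is closed under taking partners, and that
  contains the label of the first letter, contains those of all letters.
\<close>
lemma path_in_closed:
  assumes "path_edges (x # xs) \<subseteq> M" "\<bar>x\<bar> \<in> U"
    and closed: "\<And>x y. \<bar>x\<bar> \<in> U \<Longrightarrow> {x, y} \<in> M \<Longrightarrow> \<bar>y\<bar> \<in> U"
  shows "block (x # xs) \<subseteq> U"
  using assms(1,2)
proof (induction xs arbitrary: x)
  case (Cons y ys)
  then have "\<bar>- y\<bar> \<in> U" using closed by (metis insert_subset path_edges.simps(3))
  then have "block (y # ys) \<subseteq> U" using Cons by auto
  then show ?case using Cons.prems by simp
qed simp

text \<open>
  Cycles are connected and their blocks are closed under partners, so the blocks of the cycles of
  a matching are the connected components of its union with the reference matching.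
\<close>
lemma block_subset:
  assumes "is_cycle M xs" "is_cycle M ys" "t \<in> block xs" "t \<in> block ys"
  shows "block xs \<subseteq> block ys"
proof -
  obtain x where x: "x \<in> set xs" "t = \<bar>x\<bar>" using assms by auto
  then obtain as ds where xs: "xs = as @ x # ds" by (meson split_list)
  have "is_cycle M (x # ds @ as)" using cycle_rotate[of as "x # ds"] assms xs by simp
  then have "path_edges (x # ds @ as) \<subseteq> M" by (auto simp: is_cycle_def cycle_edges_def)
  moreover have "\<bar>y\<bar> \<in> block ys" if "\<bar>x\<bar> \<in> block ys" "{x, y} \<in> M" for x y
    using cycle_closed[OF assms(2) that] cycle_edges_abs assms(2) unfolding is_cycle_def by blast
  ultimately have "block (x # ds @ as) \<subseteq> block ys"
    using path_in_closed x assms by metis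
  then show ?thesis using xs by auto
qed

lemma block_eq:
  assumes "is_cycle M xs" "is_cycle M ys" "t \<in> block xs" "t \<in> block ys"
  shows "block xs = block ys"
  using block_subset assms by blast

text \<open>
  A letter determines the next one, namely as the opposite of its partner.
\<close>
lemma path_unique:
  assumes "path_edges xs \<subseteq> M" "path_edges ys \<subseteq> M" "length xs = length ys" "hd xs = hd ys"
  shows "xs = ys"
  using assms
proof (induction xs arbitrary: ys rule: path_edges.induct)
  case (2 x)
  then show ?case by (cases ys) auto
next
  case (3 x y zs)
  then obtain y' zs' where ys: "ys = x # y' # zs'"
    by (cases ys; cases "tl ys") auto
  then have "- y = - y'" using 3 edge_unique[of x "- y" "- y'"] by auto
  then have "y # zs = y' # zs'" using 3 ys by (intro "3.IH") auto
  then show ?case using ys by simp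
qed auto

lemma cycle_unique:
  assumes "is_cycle M xs" "is_cycle M ys" "hd xs = hd ys"
  shows "xs = ys"
proof (rule path_unique[OF _ _ _ assms(3)])
  have "block xs = block ys"
    using assms hd_in_set[of xs] hd_in_set[of ys]
    by (intro block_eq[of xs ys "\<bar>hd xs\<bar>"]) (auto simp: is_cycle_def simp del: hd_in_set)
  then have "set (map abs xs) = set (map abs ys)" by simp
  then show "length xs = length ys"
    using assms unfolding is_cycle_def by (metis distinct_card length_map)
  show "path_edges xs \<subseteq> M" "path_edges ys \<subseteq> M"
    using assms(1,2) by (simp_all add: is_cycle_def cycle_edges_def)
qed

end

section \<open>Canonical cycles\<close>

text \<open>
  Every component has many words, as a walk may start anywhere and go in either direction.
  The condition \<open>hd xs = Min (block xs)\<close> leaves exactly one: it fixes the first letter, and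
  the positive sign of the minimum fixes the direction.
\<close>
definition canonical_cycles :: "int set set \<Rightarrow> int list set" where
  "canonical_cycles M = {xs. is_cycle M xs \<and> hd xs = Min (block xs)}"

definition blocks :: "int set set \<Rightarrow> int set set" where
  "blocks M = block ` {xs. is_cycle M xs}"

definition roots :: "int set set \<Rightarrow> int set" where
  "roots M = hd ` canonical_cycles M"

context signed_matching begin

text \<open>
  The walk from \<open>r\<close> iterates the permutation \<open>p\<close> that sends \<open>x\<close> to the opposite of its partner,
  so it closes up at \<open>r\<close> without repeating a letter. It does not meet the opposite of a
  letter either: if \<open>f i = - f j\<close> with \<open>i < j\<close>, then taking partners gives
  \<open>f (i + 1) = - f (j - 1)\<close>, and repeating this leads to a letter that is its own opposite or
  is its own partner.
\<close>
lemma cycle_through: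
  assumes r: "\<bar>r\<bar> \<in> {1..int n}"
  shows "\<exists>xs. is_cycle M xs \<and> hd xs = r"
proof -
  define \<mu> where "\<mu> x = (THE y. {x, y} \<in> M)" for x
  have \<mu>_eq: "\<mu> x = y" if "{x, y} \<in> M" for x y
    unfolding \<mu>_def using that edge_unique by blast
  have \<mu>: "{x, \<mu> x} \<in> M" if "\<bar>x\<bar> \<in> {1..int n}" for x
    using partner_ex[OF that] \<mu>_eq by metis
  \<comment> \<open>Outside the signed points the map is the identity, so that it moves finitely many points.\<close>
  define p where "p x = (if \<bar>x\<bar> \<in> {1..int n} then - \<mu> x else x)" for x
  define q where "q x = (if \<bar>x\<bar> \<in> {1..int n} then \<mu> (- x) else x)" for x
  have \<mu>_range: "\<bar>\<mu> x\<bar> \<in> {1..int n}" if "\<bar>x\<bar> \<in> {1..int n}" for x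
    using edge_range[OF \<mu>[OF that]] by blast
  have \<mu>_\<mu>: "\<mu> (\<mu> x) = x" if "\<bar>x\<bar> \<in> {1..int n}" for x
    using \<mu>[OF that] by (intro \<mu>_eq) (simp add: insert_commute)
  have "p (q x) = x" for x
    using \<mu>_range[of "- x"] \<mu>_\<mu>[of "- x"] by (auto simp: p_def q_def)
  moreover have "q (p x) = x" for x
    using \<mu>_range[of x] \<mu>_\<mu>[of x] by (auto simp: p_def q_def)
  ultimately have "bij p" by (intro o_bij[of q]) auto
  moreover have "{x. p x \<noteq> x} \<subseteq> {- int n..int n}"
    by (auto simp: p_def split: if_splits)
  ultimately have perm: "permutation p"
    unfolding permutation using finite_subset by blast
  define f where "f i = (p ^^ i) r" for i
  have f_range: "\<bar>f i\<bar> \<in> {1..int n}" for i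
  proof (induction i)
    case (Suc i)
    then have "f (Suc i) = - \<mu> (f i)" by (simp add: f_def p_def)
    then show ?case using \<mu>_range[OF Suc] by simp
  qed (use r in \<open>simp add: f_def\<close>)
  have f_edge: "{f i, - f (Suc i)} \<in> M" for i
  proof -
    have "f (Suc i) = - \<mu> (f i)" using f_range[of i] by (simp add: f_def p_def)
    then show ?thesis using \<mu>[OF f_range[of i]] by simp
  qed
  have no_opp: "f i \<noteq> - f (i + d)" for i d
  proof (induction d arbitrary: i rule: less_induct)
    case (less d)
    consider "d = 0" | "d = 1" | d' where "d = Suc (Suc d')"
      by (metis One_nat_def not0_implies_Suc)
    then show ?case
    proof cases
      case 1
      then show ?thesis using f_range[of i] by auto
    next
      case 2
      then show ?thesis using edge_range[OF f_edge[of i]] by auto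
    next
      case 3
      show ?thesis
      proof
        assume "f i = - f (i + d)"
        then have "{f i, f (Suc i + d')} \<in> M"
          using f_edge[of "Suc i + d'"] 3 by (simp add: insert_commute)
        then have "f (Suc i + d') = - f (Suc i)" using f_edge[of i] edge_unique by blast
        then show False using less[of d' "Suc i"] 3 by auto
      qed
    qed
  qed
  have no_opp': "f i \<noteq> - f j" for i j
    using no_opp[of i "j - i"] no_opp[of j "i - j"] by (cases "i \<le> j") auto
  obtain k where k: "least_power p r = Suc k"
    using least_power_of_permutation(2)[OF perm, of r] gr0_implies_Suc by blast
  define xs where "xs = map f [0..<Suc k]"
  have "distinct xs"
    using cycle_of_permutation[OF perm, of r] by (simp add: xs_def f_def[abs_def] k)
  moreover have "inj_on abs (set xs)"
    using no_opp' by (auto simp: inj_on_def xs_def abs_eq_iff)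
  ultimately have dist: "distinct (map abs xs)" by (simp add: distinct_map)
  have "f (Suc k) = r"
    using least_power_of_permutation(1)[OF perm, of r] by (simp add: f_def k)
  moreover have hd: "hd xs = r" by (simp add: xs_def hd_map f_def del: upt_Suc)
  moreover have "last xs = f k" by (simp add: xs_def)
  ultimately have "cycle_edges xs \<subseteq> M"
    using f_edge f_edge[of k] unfolding cycle_edges_def xs_def path_edges_map_upt by auto
  moreover have "xs \<noteq> []" by (simp add: xs_def)
  ultimately have "is_cycle M xs" using dist by (simp add: is_cycle_def)
  then show ?thesis using hd by blast
qed

lemma Min_block:
  assumes "is_cycle M xs"
  shows "Min (block xs) \<in> block xs"
  using assms by (intro Min_in) (simp_all add: is_cycle_def)

text \<open>
  The walk that starts at the minimum of a block stays in this block.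
\<close>
lemma canonical_cycle_ex:
  assumes "t \<in> {1..int n}"
  shows "\<exists>xs \<in> canonical_cycles M. t \<in> block xs"
proof -
  obtain ys where ys: "is_cycle M ys" "hd ys = t" using cycle_through[of t] assms by auto
  define m where "m = Min (block ys)"
  have m: "m \<in> block ys" using Min_block ys m_def by simp
  then have "m \<in> {1..int n}" using cycle_range ys by blast
  then have "\<bar>m\<bar> = m" by auto
  then obtain zs where zs: "is_cycle M zs" "hd zs = m"
    using cycle_through[of m] \<open>m \<in> {1..int n}\<close> by auto
  have "hd ys \<in> set ys" "hd zs \<in> set zs" using ys zs by (auto simp: is_cycle_def)
  then have in_blocks: "t \<in> block ys" "m \<in> block zs"
    using ys zs \<open>\<bar>m\<bar> = m\<close> assms by force+
  have "block zs = block ys" using block_eq zs ys in_blocks m by blast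
  then show ?thesis using zs in_blocks m_def unfolding canonical_cycles_def by auto
qed

text \<open>
  Cycles whose blocks cover all labels leave no room for further blocks. In this way the
  blocks of a modified matching are known as soon as enough of its cycles are exhibited.
\<close>
lemma blocks_eq:
  assumes "\<And>xs. xs \<in> G \<Longrightarrow> is_cycle M xs" "{1..int n} \<subseteq> (\<Union>xs \<in> G. block xs)"
  shows "blocks M = block ` G"
proof
  show "blocks M \<subseteq> block ` G"
  proof
    fix S assume "S \<in> blocks M"
    then obtain xs where xs: "is_cycle M xs" "S = block xs" by (auto simp: blocks_def)
    then have "Min S \<in> S" using Min_block by simp
    moreover then have "Min S \<in> {1..int n}" using cycle_range xs by blast
    ultimately obtain ys where "ys \<in> G" "Min S \<in> block ys" "Min S \<in> block xs"
      using assms(2) xs by blast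
    then show "S \<in> block ` G" using block_eq[of xs ys] assms(1) xs by blast
  qed
  show "block ` G \<subseteq> blocks M"
    unfolding blocks_def using assms(1) by blast
qed

lemma canonical_cycles_eqI:
  assumes "G \<subseteq> canonical_cycles M" "{1..int n} \<subseteq> (\<Union>xs \<in> G. block xs)"
  shows "canonical_cycles M = G"
proof
  show "canonical_cycles M \<subseteq> G"
  proof
    fix xs assume "xs \<in> canonical_cycles M"
    then have xs: "is_cycle M xs" "hd xs = Min (block xs)" by (auto simp: canonical_cycles_def)
    then have "Min (block xs) \<in> {1..int n}" using Min_block cycle_range by blast
    then obtain ys where ys: "ys \<in> G" "Min (block xs) \<in> block ys" using assms(2) by blast
    then have ys': "is_cycle M ys" "hd ys = Min (block ys)"
      using assms(1) unfolding canonical_cycles_def by blast+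
    have "block xs = block ys"
      using block_eq[OF xs(1) ys'(1) Min_block[OF xs(1)] ys(2)] .
    then have "xs = ys" using cycle_unique[OF xs(1) ys'(1)] xs(2) ys'(2) by simp
    then show "xs \<in> G" using ys by simp
  qed
qed (rule assms(1))

lemma canonical_cycles_disjoint:
  assumes "xs \<in> canonical_cycles M" "ys \<in> canonical_cycles M" "t \<in> block xs" "t \<in> block ys"
  shows "xs = ys"
proof -
  have "is_cycle M xs" "is_cycle M ys" "hd xs = Min (block xs)" "hd ys = Min (block ys)"
    using assms by (auto simp: canonical_cycles_def)
  moreover then have "block xs = block ys" using block_eq assms by blast
  ultimately show ?thesis using cycle_unique by simp
qed

lemma canonical_hd:
  assumes "xs \<in> canonical_cycles M"
  shows "hd xs \<in> block xs" "hd xs \<in> {1..int n}"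
proof -
  have xs: "is_cycle M xs" "hd xs = Min (block xs)" using assms by (auto simp: canonical_cycles_def)
  show "hd xs \<in> block xs" using Min_block[OF xs(1)] xs(2) by simp
  then show "hd xs \<in> {1..int n}" using cycle_range[OF xs(1)] by (rule rev_subsetD)
qed

lemma inj_on_hd_canonical: "inj_on hd (canonical_cycles M)"
proof (rule inj_onI)
  fix xs ys assume *: "xs \<in> canonical_cycles M" "ys \<in> canonical_cycles M" "hd xs = hd ys"
  then have "hd xs \<in> block ys" using canonical_hd(1)[of ys] by simp
  then show "xs = ys"
    using canonical_cycles_disjoint[OF *(1,2) canonical_hd(1)[OF *(1)]] by simp
qed

lemma blocks_canonical: "blocks M = block ` canonical_cycles M"
proof (rule blocks_eq)
  show "is_cycle M xs" if "xs \<in> canonical_cycles M" for xs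
    using that by (simp add: canonical_cycles_def)
  show "{1..int n} \<subseteq> (\<Union>xs \<in> canonical_cycles M. block xs)"
    using canonical_cycle_ex by blast
qed

lemma roots_range: "roots M \<subseteq> {1..int n}"
  unfolding roots_def using canonical_hd(2) by blast

lemma card_roots: "card (roots M) = card (blocks M)"
proof -
  have "inj_on block (canonical_cycles M)"
  proof (rule inj_onI)
    fix xs ys assume *: "xs \<in> canonical_cycles M" "ys \<in> canonical_cycles M" "block xs = block ys"
    then have "hd xs \<in> block ys" using canonical_hd(1)[of xs] by simp
    then show "xs = ys"
      using canonical_cycles_disjoint[OF *(1,2) canonical_hd(1)[OF *(1)]] by simp
  qed
  then show ?thesis
    unfolding roots_def blocks_canonical by (simp add: card_image inj_on_hd_canonical)
qed

end

section \<open>Reconnecting two paths\<close>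

lemma card_blocks_split:
  assumes "finite K" "S \<noteq> {}" "T \<noteq> {}" "S \<inter> T = {}" "\<And>B. B \<in> K \<Longrightarrow> B \<inter> (S \<union> T) = {}"
  shows "card (insert S (insert T K)) = Suc (card (insert (S \<union> T) K))"
proof -
  have "S \<notin> K" "T \<notin> K" "S \<union> T \<notin> K" using assms(2-5) by blast+
  moreover have "S \<noteq> T" using assms by blast
  ultimately show ?thesis using assms(1) by simp
qed

text \<open>
  The situation common to all flips: the removed edges \<open>e1\<close> and \<open>e2\<close> leave behind two paths \<open>ps\<close>
  and \<open>qs\<close> that together fill one or two blocks of \<open>M\<close>. Only one end of each removed edge
  is specified, so that the locale applies both if \<open>ps @ qs\<close> was one cycle of \<open>M\<close> and if \<open>ps\<close>
  and \<open>qs\<close> were two.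
\<close>
locale rewiring = M: signed_matching n M + N: signed_matching n N for n M N +
  fixes ps qs :: "int list" and e1 e2 :: "int set"
  assumes nonempty: "ps \<noteq> []" "qs \<noteq> []"
    and dist: "distinct (map abs (ps @ qs))"
    and paths: "path_edges ps \<subseteq> M" "path_edges qs \<subseteq> M"
    and range: "block (ps @ qs) \<subseteq> {1..int n}"
    and ends: "last ps \<in> e1" "last qs \<in> e2"
    and retained: "M - {e1, e2} \<subseteq> N"
    and closed: "is_cycle M zs \<Longrightarrow> t \<in> block zs \<Longrightarrow> t \<in> block (ps @ qs) \<Longrightarrow>
      block zs \<subseteq> block (ps @ qs)"
begin

definition other_cycles where
  "other_cycles = {zs. is_cycle M zs \<and> block zs \<inter> block (ps @ qs) = {}}"

lemma paths_retained: "path_edges ps \<subseteq> N" "path_edges qs \<subseteq> N"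
proof -
  have "0 \<notin> set (ps @ qs)"
  proof
    assume "0 \<in> set (ps @ qs)"
    then have "\<bar>0\<bar> \<in> block (ps @ qs)" by (rule imageI)
    then show False using range by auto
  qed
  then have "last ps \<notin> e" if "e \<in> path_edges ps" for e
    using last_notin_path_edges[of ps] dist that by auto
  moreover have "last qs \<notin> e" if "e \<in> path_edges qs" for e
    using \<open>0 \<notin> set (ps @ qs)\<close> last_notin_path_edges[of qs] dist that by auto
  moreover have "\<bar>last ps\<bar> \<in> block ps" "\<bar>last qs\<bar> \<in> block qs" using nonempty by auto
  moreover have "block ps \<inter> block qs = {}" using dist by simp
  ultimately have "e1 \<notin> path_edges ps" "e2 \<notin> path_edges qs"
    "e1 \<notin> path_edges qs" "e2 \<notin> path_edges ps"
    using ends path_edges_abs[of e1 qs "last ps"] path_edges_abs[of e2 ps "last qs"]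
    by (metis, metis, metis disjoint_iff, metis disjoint_iff)
  then show "path_edges ps \<subseteq> N" "path_edges qs \<subseteq> N" using paths retained by blast+
qed

lemma other_cycles_retained:
  assumes "zs \<in> other_cycles"
  shows "is_cycle N zs"
proof -
  have zs: "is_cycle M zs" "block zs \<inter> block (ps @ qs) = {}"
    using assms by (auto simp: other_cycles_def)
  have "\<bar>last ps\<bar> \<in> block (ps @ qs)" "\<bar>last qs\<bar> \<in> block (ps @ qs)" using nonempty by auto
  then have "e1 \<notin> cycle_edges zs" "e2 \<notin> cycle_edges zs"
    using ends zs cycle_edges_abs[of e1 zs "last ps"] cycle_edges_abs[of e2 zs "last qs"]
    unfolding is_cycle_def by (metis disjoint_iff)+
  then show ?thesis using zs(1) retained unfolding is_cycle_def by blast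
qed

lemma other_cycles_cover: "{1..int n} \<subseteq> block (ps @ qs) \<union> (\<Union>zs \<in> other_cycles. block zs)"
proof
  fix t assume "t \<in> {1..int n}"
  then obtain zs where "zs \<in> canonical_cycles M" and t: "t \<in> block zs"
    using M.canonical_cycle_ex by blast
  then have zs: "is_cycle M zs" by (simp add: canonical_cycles_def)
  then show "t \<in> block (ps @ qs) \<union> (\<Union>zs \<in> other_cycles. block zs)"
  proof (cases "block zs \<inter> block (ps @ qs) = {}")
    case True
    then have "zs \<in> other_cycles" using zs by (simp add: other_cycles_def)
    then show ?thesis using t by blast
  next
    case False
    then show ?thesis using closed[OF zs] t by blast
  qed
qed

lemma blocks_M:
  assumes "\<And>xs. xs \<in> G \<Longrightarrow> is_cycle M xs" "(\<Union>xs \<in> G. block xs) = block (ps @ qs)"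
  shows "blocks M = block ` (G \<union> other_cycles)"
proof (rule M.blocks_eq)
  show "is_cycle M xs" if "xs \<in> G \<union> other_cycles" for xs
    using that assms(1) unfolding other_cycles_def by blast
  show "{1..int n} \<subseteq> (\<Union>xs \<in> G \<union> other_cycles. block xs)"
    using other_cycles_cover unfolding UN_Un assms(2) .
qed

lemma blocks_N:
  assumes "\<And>xs. xs \<in> G \<Longrightarrow> is_cycle N xs" "(\<Union>xs \<in> G. block xs) = block (ps @ qs)"
  shows "blocks N = block ` (G \<union> other_cycles)"
proof (rule N.blocks_eq)
  show "is_cycle N xs" if "xs \<in> G \<union> other_cycles" for xs
    using that assms(1) other_cycles_retained by blast
  show "{1..int n} \<subseteq> (\<Union>xs \<in> G \<union> other_cycles. block xs)"
    using other_cycles_cover unfolding UN_Un assms(2) .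
qed

lemma card_split:
  "card (block ` ({ps, qs} \<union> other_cycles)) = Suc (card (block ` ({ps @ qs} \<union> other_cycles)))"
proof -
  have "block ` other_cycles \<subseteq> Pow {1..int n}"
    using M.cycle_range by (auto simp: other_cycles_def)
  then have "finite (block ` other_cycles)" using finite_subset by blast
  moreover have "B \<inter> (block ps \<union> block qs) = {}" if "B \<in> block ` other_cycles" for B
    using that by (auto simp: other_cycles_def)
  ultimately have "card (insert (block ps) (insert (block qs) (block ` other_cycles))) =
      Suc (card (insert (block ps \<union> block qs) (block ` other_cycles)))"
    using nonempty dist by (intro card_blocks_split) auto
  then show ?thesis by (simp add: image_Un)
qed

end

section \<open>The effect of a flip on the cycles\<close>

text \<open>
  The four-cycle \<open>a, b, c, d\<close> loses the edges \<open>ab\<close>, \<open>cd\<close> of \<open>M\<close> and gains the edges \<open>ad\<close>, \<open>bc\<close> of \<open>N\<close>.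
  Stating \<open>M - {{a, b}, {c, d}} \<subseteq> N\<close> as an inclusion makes the relation pass to images under
  a relabelling of the points.
\<close>
definition flip :: "'a set set \<Rightarrow> 'a set set \<Rightarrow> bool" where
  "flip M N \<longleftrightarrow> (\<exists>a b c d. distinct [a, b, c, d] \<and> {a, b} \<in> M \<and> {c, d} \<in> M \<and>
     {a, d} \<in> N \<and> {b, c} \<in> N \<and> M - {{a, b}, {c, d}} \<subseteq> N)"

text \<open>
  The names \<open>a, b, c, d\<close> may be attached to the ends of the two removed edges in eight ways, but
  only two outcomes arise.
\<close>
lemma reconnections:
  assumes "{{a, b}, {c, d}} = {{p, q}, {s, t}}"
  shows "{{a, d}, {b, c}} = {{p, s}, {q, t}} \<or> {{a, d}, {b, c}} = {{p, t}, {q, s}}"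
proof -
  have "{a, b} = {p, q} \<and> {c, d} = {s, t} \<or> {a, b} = {s, t} \<and> {c, d} = {p, q}"
    using assms by (simp add: doubleton_eq_iff[of "{a, b}"])
  then show ?thesis
    unfolding doubleton_eq_iff by (elim disjE conjE) (simp_all add: insert_commute)
qed

text \<open>
  If the two removed edges lie on the same cycle, they cut it into two paths. Reconnecting these
  either closes each of them, which adds a block, or joins them with one of them reversed. If they
  lie on two different cycles, both ways of reconnecting produce a single cycle, and a block is
  lost. Hence a flip that preserves the parity of the number of blocks reverses a segment of
  one canonical cycle. By cutting the canonical cycle so that its first letter stays outside this
  segment, the new word starts with the same letter and is canonical as well.
\<close>
lemma flip_outcome:
  assumes M: "signed_matching n M" and N: "signed_matching n N" and "flip M N"
  shows "odd (card (roots M)) \<noteq> odd (card (roots N)) \<or>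
    (\<exists>as bs ds. as \<noteq> [] \<and> bs \<noteq> [] \<and> as @ bs @ ds \<in> canonical_cycles M \<and>
       canonical_cycles N = insert (as @ neg_rev bs @ ds) (canonical_cycles M - {as @ bs @ ds}))"
proof -
  interpret M: signed_matching n M by fact
  interpret N: signed_matching n N by fact
  obtain a b c d where abcd: "distinct [a, b, c, d]" "{a, b} \<in> M" "{c, d} \<in> M"
      "{a, d} \<in> N" "{b, c} \<in> N" "M - {{a, b}, {c, d}} \<subseteq> N"
    using assms(3) unfolding flip_def by blast
  have new_edges: "{{a, d}, {b, c}} \<subseteq> N" using abcd(4,5) by simp
  have edges_neq: "{a, b} \<noteq> {c, d}" using abcd(1) by (auto simp: doubleton_eq_iff)
  obtain xs where xs: "xs \<in> canonical_cycles M" "\<bar>a\<bar> \<in> block xs"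
    using M.canonical_cycle_ex M.edge_range[OF abcd(2)] by blast
  obtain ys where ys: "ys \<in> canonical_cycles M" "\<bar>c\<bar> \<in> block ys"
    using M.canonical_cycle_ex M.edge_range[OF abcd(3)] by blast
  have xs_cycle: "is_cycle M xs" "hd xs = Min (block xs)" and ys_cycle: "is_cycle M ys"
    using xs ys by (simp_all add: canonical_cycles_def)
  have e1: "{a, b} \<in> cycle_edges xs" and e2: "{c, d} \<in> cycle_edges ys"
    using M.cycle_closed xs_cycle ys_cycle xs ys abcd by blast+
  show ?thesis
  proof (cases "xs = ys")
    case True
    obtain as bs ds where split: "xs = as @ bs @ ds" "as \<noteq> []" "bs \<noteq> []"
        "{{a, b}, {c, d}} = {{last as, - hd bs}, {last bs, - hd (ds @ as)}}"
      using cycle_edges_split2E[OF e1 _ edges_neq] e2 True xs_cycle(1)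
      unfolding is_cycle_def by metis
    \<comment> \<open>After rotation, each removed edge leads from the end of one path to the start of the other.\<close>
    define ps where "ps = ds @ as"
    have ps: "ps \<noteq> []" "last ps = last as" using split(2) by (simp_all add: ps_def)
    have edges: "{{a, b}, {c, d}} = {{last ps, - hd bs}, {last bs, - hd ps}}"
      using split(4) by (simp add: ps(2)) (simp add: ps_def)
    have rotated: "is_cycle M (ps @ bs)"
      using M.cycle_rotate[of "as @ bs" ds] xs_cycle(1) M.cycle_rotate[of "ds" "as @ bs"]
      by (simp add: split(1) ps_def)
    have block_xs: "block (ps @ bs) = block xs" unfolding split(1) ps_def by auto
    have "rewiring n M N ps bs {last ps, - hd bs} {last bs, - hd ps}"
    proof (intro rewiring.intro rewiring_axioms.intro)
      show "ps \<noteq> []" "bs \<noteq> []" by fact+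
      show "distinct (map abs (ps @ bs))" using rotated unfolding is_cycle_def by blast
      show "path_edges ps \<subseteq> M" "path_edges bs \<subseteq> M"
        using rotated ps(1) split(3) by (auto simp: is_cycle_def cycle_edges_def path_edges_append)
      show "block (ps @ bs) \<subseteq> {1..int n}" by (rule M.cycle_range[OF rotated])
      show "M - {{last ps, - hd bs}, {last bs, - hd ps}} \<subseteq> N" using abcd(6) edges by simp
      show "block zs \<subseteq> block (ps @ bs)" if "is_cycle M zs" "t \<in> block zs" "t \<in> block (ps @ bs)" for zs t
        using M.block_subset[OF that(1) rotated that(2,3)] .
    qed (fact M N insertI1)+
    then interpret rewiring n M N ps bs "{last ps, - hd bs}" "{last bs, - hd ps}" .
    from reconnections[OF edges] consider
      (reverse) "{{a, d}, {b, c}} = {{last ps, last bs}, {- hd bs, - hd ps}}" |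
      (split) "{{a, d}, {b, c}} = {{last ps, - hd ps}, {- hd bs, last bs}}" by (rule disjE)
    then show ?thesis
    proof cases
      case reverse
      have new: "{last ps, last bs} \<in> N" "{- hd bs, - hd ps} \<in> N"
        using new_edges unfolding reverse by simp_all
      have "cycle_edges (ps @ neg_rev bs) \<subseteq> N"
        using new paths_retained ps(1) split(3)
        by (simp add: cycle_edges_def path_edges_append hd_neg_rev last_neg_rev)
      then have "is_cycle N (ps @ neg_rev bs)"
        using dist ps(1) unfolding is_cycle_def by auto
      then have "is_cycle N (as @ neg_rev bs @ ds)"
        using N.cycle_rotate[of "ds" "as @ neg_rev bs"] by (simp add: ps_def)
      moreover have block': "block (as @ neg_rev bs @ ds) = block xs"
        by (simp add: split(1) image_Un)
      moreover have "hd (as @ neg_rev bs @ ds) = hd xs" using split(1,2) by simp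
      ultimately have new_cycle: "as @ neg_rev bs @ ds \<in> canonical_cycles N"
        using xs_cycle(2) by (simp add: canonical_cycles_def)
      have old_cycles: "zs \<in> canonical_cycles N" if "zs \<in> canonical_cycles M - {xs}" for zs
      proof -
        have "block zs \<inter> block xs = {}"
          using that M.canonical_cycles_disjoint[OF _ xs(1)] by blast
        then have "zs \<in> other_cycles" using that block_xs
          by (simp add: other_cycles_def canonical_cycles_def)
        then show ?thesis using other_cycles_retained that by (simp add: canonical_cycles_def)
      qed
      have "canonical_cycles N = insert (as @ neg_rev bs @ ds) (canonical_cycles M - {xs})"
      proof (rule N.canonical_cycles_eqI)
        show "insert (as @ neg_rev bs @ ds) (canonical_cycles M - {xs}) \<subseteq> canonical_cycles N"
          using new_cycle old_cycles by blast
        show "{1..int n} \<subseteq> (\<Union>zs \<in> insert (as @ neg_rev bs @ ds) (canonical_cycles M - {xs}). block zs)"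
        proof
          fix t assume "t \<in> {1..int n}"
          then obtain zs where "zs \<in> canonical_cycles M" "t \<in> block zs"
            using M.canonical_cycle_ex by blast
          then show "t \<in> (\<Union>zs \<in> insert (as @ neg_rev bs @ ds) (canonical_cycles M - {xs}). block zs)"
            using block' by (cases "zs = xs") auto
        qed
      qed
      then show ?thesis using split(1-3) xs(1) by blast
    next
      case split
      have "{last ps, - hd ps} \<in> N" "{last bs, - hd bs} \<in> N"
        using new_edges unfolding split by (simp_all add: insert_commute)
      then have "is_cycle N ps" "is_cycle N bs"
        using paths_retained dist nonempty by (auto simp: is_cycle_def cycle_edges_def)
      then have "blocks N = block ` ({ps, bs} \<union> other_cycles)" by (intro blocks_N) auto
      moreover have "blocks M = block ` ({ps @ bs} \<union> other_cycles)"
        using rotated by (intro blocks_M) auto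
      ultimately show ?thesis
        using card_split by (simp only: M.card_roots N.card_roots) simp
    qed
  next
    case False
    obtain as ds where split_xs: "xs = as @ ds" "as \<noteq> []" "{a, b} = {last as, - hd (ds @ as)}"
      using cycle_edges_splitE[OF e1] xs_cycle(1) unfolding is_cycle_def by metis
    obtain cs fs where split_ys: "ys = cs @ fs" "cs \<noteq> []" "{c, d} = {last cs, - hd (fs @ cs)}"
      using cycle_edges_splitE[OF e2] ys_cycle unfolding is_cycle_def by metis
    define ps where "ps = ds @ as"
    define qs where "qs = fs @ cs"
    have nonempty: "ps \<noteq> []" "qs \<noteq> []" and last: "last ps = last as" "last qs = last cs"
      using split_xs(2) split_ys(2) by (simp_all add: ps_def qs_def)
    have edges: "{{a, b}, {c, d}} = {{last ps, - hd ps}, {last qs, - hd qs}}"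
      unfolding split_xs(3) split_ys(3) last by (simp only: ps_def qs_def)
    have rotated: "is_cycle M ps" "is_cycle M qs"
      using M.cycle_rotate xs_cycle(1) ys_cycle split_xs(1) split_ys(1) by (auto simp: ps_def qs_def)
    have block_ps: "block ps = block xs" and block_qs: "block qs = block ys"
      unfolding split_xs(1) split_ys(1) ps_def qs_def by auto
    have disj: "block ps \<inter> block qs = {}"
      unfolding block_ps block_qs using M.canonical_cycles_disjoint[OF xs(1) ys(1)] False by blast
    have "rewiring n M N ps qs {last ps, - hd ps} {last qs, - hd qs}"
    proof (intro rewiring.intro rewiring_axioms.intro)
      show "ps \<noteq> []" "qs \<noteq> []" by fact+
      show "distinct (map abs (ps @ qs))" using rotated disj by (simp add: is_cycle_def)
      show "path_edges ps \<subseteq> M" "path_edges qs \<subseteq> M"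
        using rotated by (simp_all add: is_cycle_def cycle_edges_def)
      show "block (ps @ qs) \<subseteq> {1..int n}"
        using M.cycle_range[OF rotated(1)] M.cycle_range[OF rotated(2)] by (simp add: image_Un)
      show "M - {{last ps, - hd ps}, {last qs, - hd qs}} \<subseteq> N" using abcd(6) edges by simp
      show "block zs \<subseteq> block (ps @ qs)" if "is_cycle M zs" "t \<in> block zs" "t \<in> block (ps @ qs)" for zs t
      proof -
        from that(3) have "t \<in> block ps \<or> t \<in> block qs" by auto
        then have "block zs \<subseteq> block ps \<or> block zs \<subseteq> block qs"
          using M.block_subset[OF that(1) rotated(1) that(2)]
            M.block_subset[OF that(1) rotated(2) that(2)] by blast
        then show ?thesis unfolding set_append image_Un by blast
      qed
    qed (fact M N insertI1)+
    then interpret rewiring n M N ps qs "{last ps, - hd ps}" "{last qs, - hd qs}" .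
    have "\<exists>zs. is_cycle N zs \<and> block zs = block (ps @ qs)"
    proof -
      from reconnections[OF edges] consider
        (rev) "{{a, d}, {b, c}} = {{last ps, last qs}, {- hd ps, - hd qs}}" |
        (straight) "{{a, d}, {b, c}} = {{last ps, - hd qs}, {- hd ps, last qs}}" by (rule disjE)
      then show ?thesis
      proof cases
        case rev
        have "{last ps, last qs} \<in> N" "{- hd qs, - hd ps} \<in> N"
          using new_edges unfolding rev by (simp_all add: insert_commute)
        then have "cycle_edges (ps @ neg_rev qs) \<subseteq> N"
          using paths_retained nonempty
          by (simp add: cycle_edges_def path_edges_append hd_neg_rev last_neg_rev)
        then have "is_cycle N (ps @ neg_rev qs)" using dist nonempty unfolding is_cycle_def by auto
        then show ?thesis by (intro exI[of _ "ps @ neg_rev qs"]) (simp add: image_Un)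
      next
        case straight
        have "{last ps, - hd qs} \<in> N" "{last qs, - hd ps} \<in> N"
          using new_edges unfolding straight by (simp_all add: insert_commute)
        then have "cycle_edges (ps @ qs) \<subseteq> N"
          using paths_retained nonempty by (simp add: cycle_edges_def path_edges_append)
        then show ?thesis using dist nonempty unfolding is_cycle_def by blast
      qed
    qed
    then obtain zs where zs: "is_cycle N zs" "block zs = block (ps @ qs)" by blast
    have "blocks M = block ` ({ps, qs} \<union> other_cycles)"
      using rotated by (intro blocks_M) auto
    moreover have "blocks N = block ` ({zs} \<union> other_cycles)"
      using zs by (intro blocks_N) auto
    moreover have "block ` ({zs} \<union> other_cycles) = block ` ({ps @ qs} \<union> other_cycles)"
      using zs(2) by (simp only: image_Un image_insert image_empty)
    ultimately show ?thesis
      using card_split by (simp only: M.card_roots N.card_roots) simp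
  qed
qed

section \<open>Words of matchings\<close>

text \<open>
  The meaning is clear for \<open>r \<in> roots M\<close> only; elsewhere the value is arbitrary.
\<close>
definition root_word :: "int set set \<Rightarrow> int \<Rightarrow> int list" where
  "root_word M r = (THE xs. xs \<in> canonical_cycles M \<and> hd xs = r)"

definition word :: "int set set \<Rightarrow> int list" where
  "word M = concat (map (root_word M) (sorted_list_of_set (roots M)))"

context signed_matching begin

lemma root_word_hd: "xs \<in> canonical_cycles M \<Longrightarrow> root_word M (hd xs) = xs"
  unfolding root_word_def by (rule the_equality) (auto dest: inj_onD[OF inj_on_hd_canonical])

lemma root_word_canonical:
  assumes "r \<in> roots M"
  shows "root_word M r \<in> canonical_cycles M" "hd (root_word M r) = r"
proof -
  obtain xs where "xs \<in> canonical_cycles M" "r = hd xs" using assms unfolding roots_def by blast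
  then show "root_word M r \<in> canonical_cycles M" "hd (root_word M r) = r"
    using root_word_hd[of xs] by simp_all
qed

lemma finite_roots: "finite (roots M)"
  using finite_subset[OF roots_range] by simp

lemma set_word: "block (word M) = {1..int n}"
proof
  show "block (word M) \<subseteq> {1..int n}"
  proof
    fix t assume "t \<in> block (word M)"
    then obtain r where "r \<in> roots M" "t \<in> block (root_word M r)"
      using finite_roots by (auto simp: word_def)
    then show "t \<in> {1..int n}"
      using root_word_canonical(1)[of r] cycle_range[of "root_word M r"]
      unfolding canonical_cycles_def by blast
  qed
  show "{1..int n} \<subseteq> block (word M)"
  proof
    fix t assume "t \<in> {1..int n}"
    then obtain xs where xs: "xs \<in> canonical_cycles M" "t \<in> block xs"
      using canonical_cycle_ex by blast
    then have "hd xs \<in> roots M" by (simp add: roots_def)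
    moreover have "t \<in> block (root_word M (hd xs))" using xs root_word_hd by simp
    ultimately show "t \<in> block (word M)" using finite_roots by (auto simp: word_def)
  qed
qed

lemma distinct_concat_root_words:
  assumes "distinct rs" "set rs \<subseteq> roots M"
  shows "distinct (map abs (concat (map (root_word M) rs)))"
  using assms
proof (induction rs)
  case (Cons r rs)
  have r: "root_word M r \<in> canonical_cycles M" "hd (root_word M r) = r"
    using root_word_canonical Cons.prems by auto
  have "block (root_word M r) \<inter> block (root_word M s) = {}" if "s \<in> set rs" for s
  proof -
    have s: "root_word M s \<in> canonical_cycles M" "hd (root_word M s) = s"
      using root_word_canonical Cons.prems that by auto
    have "root_word M r \<noteq> root_word M s"
    proof
      assume "root_word M r = root_word M s"
      then have "r = s" using r(2) s(2) by metis
      then show False using that Cons.prems by simp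
    qed
    then show ?thesis using canonical_cycles_disjoint[OF r(1) s(1)] by blast
  qed
  then have "block (root_word M r) \<inter> block (concat (map (root_word M) rs)) = {}"
    by auto
  moreover have "distinct (map abs (root_word M r))"
    using r(1) by (simp add: canonical_cycles_def is_cycle_def)
  moreover have "distinct (map abs (concat (map (root_word M) rs)))"
    using Cons.IH Cons.prems by simp
  ultimately show ?case by (simp add: Int_commute)
qed simp

lemma distinct_word: "distinct (map abs (word M))"
  unfolding word_def using finite_roots by (intro distinct_concat_root_words) simp_all

end

text \<open>
  Concatenating the canonical cycles in the order of their roots turns the reversal of a
  segment of one cycle into the reversal of a segment of the whole word, because the roots, and
  thus the order of the cycles, stay the same.
\<close>
lemma word_reversal:
  assumes M: "signed_matching n M" and N: "signed_matching n N"
    and as: "as \<noteq> []" and old: "as @ bs @ ds \<in> canonical_cycles M"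
    and new: "canonical_cycles N = insert (as @ neg_rev bs @ ds) (canonical_cycles M - {as @ bs @ ds})"
  shows "roots N = roots M"
    and "\<exists>us vs. word M = us @ bs @ vs \<and> word N = us @ neg_rev bs @ vs"
    and "block bs \<inter> roots M = {}"
proof -
  interpret M: signed_matching n M by fact
  interpret N: signed_matching n N by fact
  define r where "r = hd as"
  have hds: "hd (as @ bs @ ds) = r" "hd (as @ neg_rev bs @ ds) = r" using as by (simp_all add: r_def)
  have r: "r \<in> roots M" unfolding roots_def using old hds by (metis imageI)
  have "hd ` canonical_cycles M = insert r (hd ` (canonical_cycles M - {as @ bs @ ds}))"
    using old hds(1) by (metis image_insert insert_Diff)
  then show roots: "roots N = roots M"
    unfolding roots_def new image_insert hds(2) by simp
  have word_r: "root_word M r = as @ bs @ ds" "root_word N r = as @ neg_rev bs @ ds"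
    using M.root_word_hd[OF old] N.root_word_hd[of "as @ neg_rev bs @ ds"] new hds by simp_all
  have word_other: "root_word N s = root_word M s" if "s \<in> roots M" "s \<noteq> r" for s
  proof -
    have s: "root_word M s \<in> canonical_cycles M" "hd (root_word M s) = s"
      using M.root_word_canonical that(1) by blast+
    then have "root_word M s \<noteq> as @ bs @ ds" using hds(1) that(2) by metis
    then have "root_word M s \<in> canonical_cycles N" using new s(1) by simp
    then show ?thesis using N.root_word_hd[of "root_word M s"] s(2) by simp
  qed
  obtain ls ks where split: "sorted_list_of_set (roots M) = ls @ r # ks"
    using r M.finite_roots by (metis set_sorted_list_of_set split_list)
  have "distinct (ls @ r # ks)" unfolding split[symmetric] by simp
  moreover have "set (ls @ r # ks) = roots M"
    unfolding split[symmetric] using M.finite_roots by simp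
  ultimately have others: "map (root_word N) ls = map (root_word M) ls"
      "map (root_word N) ks = map (root_word M) ks"
    using word_other by auto
  show "\<exists>us vs. word M = us @ bs @ vs \<and> word N = us @ neg_rev bs @ vs"
    unfolding word_def roots split
    by (intro exI[of _ "concat (map (root_word M) ls) @ as"] exI[of _ "ds @ concat (map (root_word M) ks)"])
      (simp add: others word_r)
  \<comment> \<open>A root in \<open>bs\<close> could only be the first letter of the cycle at hand, which belongs to \<open>as\<close>.\<close>
  show "block bs \<inter> roots M = {}"
  proof (rule ccontr)
    assume "block bs \<inter> roots M \<noteq> {}"
    then obtain s where s: "s \<in> block bs" "s \<in> roots M" by blast
    then have "root_word M s \<in> canonical_cycles M" "s \<in> block (root_word M s)"
      using M.root_word_canonical M.canonical_hd(1) by metis+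
    moreover have "s \<in> block (as @ bs @ ds)" using s(1) by auto
    ultimately have "root_word M s = as @ bs @ ds" using M.canonical_cycles_disjoint old by blast
    then have "s = r" using M.root_word_canonical(2)[OF s(2)] hds by simp
    moreover have "r \<in> block as" using M.canonical_hd(2)[OF old] hds as
      by (simp add: r_def) (metis abs_of_pos hd_in_set image_eqI zero_less_one order_less_le_trans)
    moreover have "distinct (map abs (as @ bs @ ds))"
      using old by (simp add: canonical_cycles_def is_cycle_def)
    ultimately show False using s(1) by auto
  qed
qed

text \<open>
  These are the labels to be deleted from the word. Two roots are available if the number of
  cycles is even, as it is not zero for a nonempty set of points. The choice of the roots depends on \<open>roots M\<close> alone and is thus the same before and after a reversal.
\<close>
definition dropped :: "int set set \<Rightarrow> int set" where
  "dropped M = set (take (if odd (card (roots M)) then 1 else 2) (sorted_list_of_set (roots M)))"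

definition reduced_word :: "int set set \<Rightarrow> int list" where
  "reduced_word M = filter (\<lambda>x. \<bar>x\<bar> \<notin> dropped M) (word M)"

context signed_matching begin

lemma dropped_roots: "dropped M \<subseteq> roots M"
  unfolding dropped_def
  using set_take_subset[of _ "sorted_list_of_set (roots M)"] finite_roots by simp

lemma card_dropped:
  assumes "n > 0"
  shows "card (dropped M) = (if odd (card (roots M)) then 1 else 2)"
proof -
  obtain xs where "xs \<in> canonical_cycles M" using canonical_cycle_ex[of 1] assms by auto
  then have "roots M \<noteq> {}" by (auto simp: roots_def)
  then have "card (roots M) > 0" using finite_roots by (simp add: card_gt_0_iff)
  then have "(if odd (card (roots M)) then 1 else 2) \<le> card (roots M)"
    by (auto elim!: evenE)
  then show ?thesis
    unfolding dropped_def by (subst distinct_card) (auto simp: distinct_take min_def)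
qed

lemma reduced_word_letters:
  "map abs (reduced_word M) \<in> permutations_of_set ({1..int n} - dropped M)"
proof -
  have eq: "map abs (reduced_word M) = filter (\<lambda>t. t \<notin> dropped M) (map abs (word M))"
    unfolding reduced_word_def by (simp add: filter_map comp_def)
  show ?thesis
    unfolding eq permutations_of_set_def using distinct_word set_word
    by (simp add: distinct_filter set_diff_eq del: map_map)
qed

end

text \<open>
  Roots can be deleted from the words without harm, since a reversed segment never contains one.
\<close>
lemma reduced_word_reversal:
  assumes "signed_matching n M" "signed_matching n N"
    "as \<noteq> []" "bs \<noteq> []" "as @ bs @ ds \<in> canonical_cycles M"
    "canonical_cycles N = insert (as @ neg_rev bs @ ds) (canonical_cycles M - {as @ bs @ ds})"
  shows "dropped N = dropped M"
    and "\<exists>us vs. reduced_word M = us @ bs @ vs \<and> reduced_word N = us @ neg_rev bs @ vs"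
proof -
  note rev = word_reversal[OF assms(1,2,3,5,6)]
  interpret M: signed_matching n M by fact
  show dropped: "dropped N = dropped M" unfolding dropped_def rev(1) ..
  obtain us vs where uv: "word M = us @ bs @ vs" "word N = us @ neg_rev bs @ vs"
    using rev(2) by blast
  have keep: "filter (\<lambda>x. \<bar>x\<bar> \<notin> dropped M) xs = xs" if "block xs = block bs" for xs
  proof -
    have "\<bar>x\<bar> \<notin> dropped M" if "x \<in> set xs" for x
      using rev(3) M.dropped_roots \<open>block xs = block bs\<close> that by blast
    then show ?thesis by (simp add: filter_id_conv)
  qed
  show "\<exists>us vs. reduced_word M = us @ bs @ vs \<and> reduced_word N = us @ neg_rev bs @ vs"
    unfolding reduced_word_def dropped uv filter_append
    using keep[of bs] keep[of "neg_rev bs"] by auto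
qed

section \<open>Colouring\<close>

text \<open>
  A proper colouring of the signed reversal graph in which the set \<open>T\<close> takes the place of the
  labels \<open>1, \<dots>, k\<close>; deleting roots leaves such sets.
\<close>
definition reversal_colouring :: "int set \<Rightarrow> (int list \<Rightarrow> nat) \<Rightarrow> bool" where
  "reversal_colouring T c \<longleftrightarrow>
     (\<forall>w. map abs w \<in> permutations_of_set T \<longrightarrow>
        c w < chromatic_number (signed_reversal_graph (card T))) \<and>
     (\<forall>us bs vs. bs \<noteq> [] \<longrightarrow> map abs (us @ bs @ vs) \<in> permutations_of_set T \<longrightarrow>
        c (us @ bs @ vs) \<noteq> c (us @ neg_rev bs @ vs))"

text \<open>
  A bijection from \<open>T\<close> to \<open>{1..k}\<close>, extended to an odd map on the signed letters, commutes
  with reversals. For this, zero must not be a letter, as it would be its own opposite.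
\<close>
lemma reversal_colouring_ex:
  assumes "finite T" "0 \<notin> T"
  shows "\<exists>c. reversal_colouring T c"
proof -
  define k where "k = card T"
  have "card T = card {1..int k}" by (simp add: k_def)
  then obtain f where f: "bij_betw f T {1..int k}"
    using assms(1) finite_same_card_bij[of T "{1..int k}"] by auto
  obtain c where c: "proper_colouring (signed_reversal_graph k)
      (chromatic_number (signed_reversal_graph k)) c"
    using chromatic_number_attained pair_graph_signed_reversal_graph by blast
  define g where "g x = (if x < 0 then - f \<bar>x\<bar> else f \<bar>x\<bar>)" for x
  have f_pos: "f t \<ge> 1" if "t \<in> T" for t
    using bij_betwE[OF f] that by auto
  have relabel: "map g w \<in> signed_permutations k" if w: "map abs w \<in> permutations_of_set T" for w
  proof -
    have wT: "\<bar>x\<bar> \<in> T" if "x \<in> set w" for x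
      using w that unfolding permutations_of_set_def by force
    then have "\<bar>g x\<bar> = f \<bar>x\<bar>" if "x \<in> set w" for x
      using f_pos[OF wT[OF that]] by (auto simp: g_def)
    then have eq: "map abs (map g w) = map f (map abs w)" by simp
    have w': "set (map abs w) = T" "distinct (map abs w)"
      using w by (simp_all add: permutations_of_set_def)
    have "set (map f (map abs w)) = {1..int k}"
      using f w'(1) by (metis bij_betw_imp_surj_on set_map)
    moreover have "distinct (map f (map abs w))"
      using f w' by (metis bij_betw_imp_inj_on distinct_map)
    ultimately have "map f (map abs w) \<in> permutations_of_set {1..int k}"
      by (rule permutations_of_setI)
    then show ?thesis unfolding signed_permutations_def eq[symmetric] by simp
  qed
  have "c (map g w) < chromatic_number (signed_reversal_graph k)"
    if "map abs w \<in> permutations_of_set T" for w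
    using c relabel[OF that] by (simp add: proper_colouring_def signed_reversal_graph_def)
  moreover have "c (map g (us @ bs @ vs)) \<noteq> c (map g (us @ neg_rev bs @ vs))"
    if "bs \<noteq> []" and w: "map abs (us @ bs @ vs) \<in> permutations_of_set T" for us bs vs
  proof -
    have "set (map abs (us @ neg_rev bs @ vs)) = set (map abs (us @ bs @ vs))"
      by (simp only: set_map set_append image_Un neg_rev_simps)
    moreover have "distinct (map abs (us @ neg_rev bs @ vs)) = distinct (map abs (us @ bs @ vs))"
      by (simp only: map_append distinct_append set_map set_append neg_rev_simps)
    ultimately have w': "map abs (us @ neg_rev bs @ vs) \<in> permutations_of_set T"
      using w unfolding permutations_of_set_def by simp
    have "x \<noteq> 0" if "x \<in> set bs" for x
    proof -
      have "\<bar>x\<bar> \<in> set (map abs (us @ bs @ vs))" using that by simp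
      then have "\<bar>x\<bar> \<in> T" using w unfolding permutations_of_set_def by blast
      then show ?thesis using assms(2) by auto
    qed
    then have g_rev: "map g (neg_rev bs) = neg_rev (map g bs)"
      by (auto simp: neg_rev_def rev_map g_def)
    have len: "length (us @ bs @ vs) = k"
      using length_signed_permutations[OF relabel[OF w]] by simp
    let ?i = "Suc (length us)" and ?j = "length us + length bs"
    have "map g (us @ neg_rev bs @ vs) = signed_reversal ?i ?j (map g (us @ bs @ vs))"
      by (simp add: signed_reversal_def g_rev) (simp add: neg_rev_def)
    moreover have "1 \<le> ?i" "?i \<le> ?j" "?j \<le> k"
      using \<open>bs \<noteq> []\<close> len by (auto simp: Suc_le_eq)
    ultimately have "\<exists>i j. 1 \<le> i \<and> i \<le> j \<and> j \<le> k \<and>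
        map g (us @ neg_rev bs @ vs) = signed_reversal i j (map g (us @ bs @ vs))" by blast
    then have "(map g (us @ bs @ vs), map g (us @ neg_rev bs @ vs)) \<in> parcs (signed_reversal_graph k)"
      unfolding signed_reversal_graph_def using relabel[OF w] relabel[OF w'] by simp
    then show ?thesis using c unfolding proper_colouring_def by blast
  qed
  ultimately have "reversal_colouring T (\<lambda>w. c (map g w))"
    unfolding reversal_colouring_def k_def by blast
  then show ?thesis by blast
qed

text \<open>
  Matchings with an odd and with an even number of cycles use disjoint sets of colours. Within
  one parity class, a flip is a signed reversal of the reduced words, which therefore receive
  different colours.
\<close>
lemma signed_matchings_colouring:
  assumes "n > 0"
  shows "\<exists>col. (\<forall>M. signed_matching n M \<longrightarrow>
           col M < chromatic_number (signed_reversal_graph (n - 1))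
             + chromatic_number (signed_reversal_graph (n - 2))) \<and>
         (\<forall>M N. signed_matching n M \<longrightarrow> signed_matching n N \<longrightarrow> flip M N \<longrightarrow> col M \<noteq> (col N :: nat))"
proof -
  let ?\<chi> = "\<lambda>k. chromatic_number (signed_reversal_graph k)"
  have "\<forall>T. \<exists>c. finite T \<and> 0 \<notin> T \<longrightarrow> reversal_colouring T c"
    using reversal_colouring_ex by blast
  then obtain c where c: "\<And>T. finite T \<Longrightarrow> 0 \<notin> T \<Longrightarrow> reversal_colouring T (c T)"
    by metis
  define letters where "letters M = {1..int n} - dropped M" for M
  define base where "base M = c (letters M) (reduced_word M)" for M
  define col where "col M = (if odd (card (roots M)) then base M else ?\<chi> (n - 1) + base M)" for M
  have letters: "reversal_colouring (letters M) (c (letters M))" for M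
    by (rule c) (simp_all add: letters_def)
  have base_less: "base M < ?\<chi> (n - (if odd (card (roots M)) then 1 else 2))"
    if "signed_matching n M" for M
  proof -
    interpret signed_matching n M by fact
    have sub: "dropped M \<subseteq> {1..int n}" using dropped_roots roots_range by (rule subset_trans)
    then have "card (letters M) = n - card (dropped M)"
      unfolding letters_def by (subst card_Diff_subset) (auto intro: finite_subset)
    then have "card (letters M) = n - (if odd (card (roots M)) then 1 else 2)"
      using card_dropped[OF assms] by simp
    moreover have "base M < ?\<chi> (card (letters M))"
      using letters[of M] reduced_word_letters
      unfolding reversal_colouring_def base_def letters_def by blast
    ultimately show ?thesis by simp
  qed
  have "col M < ?\<chi> (n - 1) + ?\<chi> (n - 2)" if "signed_matching n M" for M
    using base_less[OF that] by (auto simp: col_def split: if_splits)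
  moreover have "col M \<noteq> col N"
    if M: "signed_matching n M" and N: "signed_matching n N" and "flip M N" for M N
    using flip_outcome[OF that]
  proof (elim disjE exE conjE)
    assume parity: "odd (card (roots M)) \<noteq> odd (card (roots N))"
    show ?thesis
      using parity base_less[OF M] base_less[OF N] by (auto simp: col_def split: if_splits)
  next
    fix as bs ds
    assume *: "as \<noteq> []" "bs \<noteq> []" "as @ bs @ ds \<in> canonical_cycles M"
      "canonical_cycles N = insert (as @ neg_rev bs @ ds) (canonical_cycles M - {as @ bs @ ds})"
    note rev = reduced_word_reversal[OF M N *(1,2,3,4)]
    have roots: "roots N = roots M" using word_reversal(1)[OF M N *(1,3,4)] .
    have same: "letters N = letters M" unfolding letters_def rev(1) ..
    obtain us vs where uv: "reduced_word M = us @ bs @ vs" "reduced_word N = us @ neg_rev bs @ vs"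
      using rev(2) by blast
    have "map abs (us @ bs @ vs) \<in> permutations_of_set (letters M)"
      using signed_matching.reduced_word_letters[OF M] unfolding letters_def uv .
    then have "base M \<noteq> base N"
      using letters[of M] *(2) unfolding reversal_colouring_def base_def same uv by blast
    then show ?thesis by (simp add: col_def roots)
  qed
  ultimately show ?thesis by blast
qed

section \<open>From the complete graph to signed points\<close>

text \<open>
  The reference matching of the complete graph consists of the edges \<open>{2 i - 1, 2 i}\<close>, whose ends
  become \<open>i\<close> and \<open>- i\<close>.
\<close>
definition signed_label :: "nat \<Rightarrow> int" where
  "signed_label v = (if odd v then int (Suc v div 2) else - int (v div 2))"

lemma bij_betw_signed_label: "bij_betw signed_label {1..2 * n} {x. \<bar>x\<bar> \<in> {1..int n}}"
proof (rule bij_betw_byWitness[where f' = "\<lambda>x. if x > 0 then 2 * nat x - 1 else 2 * nat (- x)"])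
  show "\<forall>v \<in> {1..2 * n}. (if signed_label v > 0 then 2 * nat (signed_label v) - 1
      else 2 * nat (- signed_label v)) = v"
    by (auto simp: signed_label_def elim!: oddE)
  show "\<forall>x \<in> {x. \<bar>x\<bar> \<in> {1..int n}}.
      signed_label (if x > 0 then 2 * nat x - 1 else 2 * nat (- x)) = x"
    by (auto simp: signed_label_def)
  show "signed_label ` {1..2 * n} \<subseteq> {x. \<bar>x\<bar> \<in> {1..int n}}"
    by (auto simp: signed_label_def elim!: oddE evenE)
  show "(\<lambda>x. if x > 0 then 2 * nat x - 1 else 2 * nat (- x)) ` {x. \<bar>x\<bar> \<in> {1..int n}} \<subseteq> {1..2 * n}"
    by auto
qed

lemma complete_graph_edgeE:
  assumes "perfect_matching (complete_graph m) M" "e \<in> M"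
  obtains u v where "e = {u, v}" "u \<noteq> v" "u \<in> {1..m}" "v \<in> {1..m}"
  using assms unfolding perfect_matching_def undirected_edges_def complete_graph_def by auto

lemma complete_graph_edge_unique:
  assumes "perfect_matching (complete_graph m) M" "{x, y} \<in> M" "{x, z} \<in> M"
  shows "y = z"
proof -
  have "x \<in> {1..m}"
    using complete_graph_edgeE[OF assms(1,2)] by (metis insertI1 insertE singletonD)
  then have "\<exists>!e. e \<in> M \<and> x \<in> e"
    using assms(1) unfolding perfect_matching_def complete_graph_def by simp
  then have "{x, y} = {x, z}" using assms(2,3) by (metis insertI1)
  then show ?thesis by (auto simp: doubleton_eq_iff)
qed

lemma signed_matching_image:
  assumes M: "perfect_matching (complete_graph (2 * n)) M"
  shows "signed_matching n ((`) signed_label ` M)"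
proof
  note inj = bij_betw_imp_inj_on[OF bij_betw_signed_label[of n]]
  note range = bij_betw_imp_surj_on[OF bij_betw_signed_label[of n]]
  fix e assume "e \<in> (`) signed_label ` M"
  then obtain e0 where e0: "e0 \<in> M" "e = signed_label ` e0" by blast
  obtain u v where uv: "e0 = {u, v}" "u \<noteq> v" "u \<in> {1..2 * n}" "v \<in> {1..2 * n}"
    using complete_graph_edgeE[OF M e0(1)] .
  have "signed_label u \<noteq> signed_label v" using inj_onD[OF inj] uv(2-4) by blast
  moreover have "\<bar>signed_label u\<bar> \<in> {1..int n}" "\<bar>signed_label v\<bar> \<in> {1..int n}"
    using imageI[OF uv(3), of signed_label] imageI[OF uv(4), of signed_label]
    unfolding range by simp_all
  moreover have "e = {signed_label u, signed_label v}" using e0(2) uv(1) by simp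
  ultimately show "\<exists>x y. e = {x, y} \<and> x \<noteq> y \<and> \<bar>x\<bar> \<in> {1..int n} \<and> \<bar>y\<bar> \<in> {1..int n}"
    by blast
next
  note inj = bij_betw_imp_inj_on[OF bij_betw_signed_label[of n]]
  note range = bij_betw_imp_surj_on[OF bij_betw_signed_label[of n]]
  fix x assume "\<bar>x\<bar> \<in> {1..int n}"
  then have "x \<in> signed_label ` {1..2 * n}" unfolding range by simp
  then obtain v where v: "v \<in> {1..2 * n}" "x = signed_label v" by blast
  have "\<exists>!e. e \<in> M \<and> v \<in> e"
    using M v(1) unfolding perfect_matching_def complete_graph_def by simp
  then obtain e0 where e0: "e0 \<in> M" "v \<in> e0" "\<And>e. e \<in> M \<Longrightarrow> v \<in> e \<Longrightarrow> e = e0" by blast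
  show "\<exists>!e. e \<in> (`) signed_label ` M \<and> x \<in> e"
  proof (rule ex1I)
    show "signed_label ` e0 \<in> (`) signed_label ` M \<and> x \<in> signed_label ` e0"
      using e0(1,2) v(2) by blast
    fix e assume "e \<in> (`) signed_label ` M \<and> x \<in> e"
    then obtain e1 u where e1: "e1 \<in> M" "e = signed_label ` e1" "u \<in> e1" "x = signed_label u"
      by blast
    have "e1 \<subseteq> {1..2 * n}" using complete_graph_edgeE[OF M e1(1)] by blast
    then have "u = v" using inj_onD[OF inj] e1(3,4) v by blast
    then show "e = signed_label ` e0" using e0(3) e1 by blast
  qed
qed

text \<open>
  Two edges of the four-cycle that share a vertex cannot belong to the same matching, so its
  edges alternate between \<open>M\<close> and \<open>N\<close>.
\<close>
lemma four_cycle_flip: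
  assumes M: "perfect_matching (complete_graph m) M" and N: "perfect_matching (complete_graph m) N"
    and "is_four_cycle (sym_diff M N)"
  shows "flip M N"
proof -
  obtain a b c d where dist: "distinct [a, b, c, d]"
      and eq: "sym_diff M N = {{a, b}, {b, c}, {c, d}, {d, a}}"
    using assms(3) unfolding is_four_cycle_def by blast
  have alternating: "{x, y} \<in> M \<longleftrightarrow> {x, z} \<in> N" if "{x, y} \<in> sym_diff M N" "{x, z} \<in> sym_diff M N" "y \<noteq> z" for x y z
    using complete_graph_edge_unique[OF M, of x y z] complete_graph_edge_unique[OF N, of x y z] that
    by blast
  have "{b, a} \<in> M \<longleftrightarrow> {b, c} \<in> N" "{c, b} \<in> M \<longleftrightarrow> {c, d} \<in> N"
    "{d, c} \<in> M \<longleftrightarrow> {d, a} \<in> N" "{a, d} \<in> M \<longleftrightarrow> {a, b} \<in> N"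
    by (rule alternating; use dist in \<open>simp add: eq insert_commute\<close>)+
  then have alt: "{a, b} \<in> M \<longleftrightarrow> {b, c} \<in> N" "{b, c} \<in> M \<longleftrightarrow> {c, d} \<in> N"
    "{c, d} \<in> M \<longleftrightarrow> {d, a} \<in> N" "{d, a} \<in> M \<longleftrightarrow> {a, b} \<in> N"
    by (simp_all add: insert_commute)
  have one: "e \<in> M \<longleftrightarrow> e \<notin> N" if "e \<in> {{a, b}, {b, c}, {c, d}, {d, a}}" for e
    using that unfolding eq[symmetric] by blast
  have kept: "M - {{a, b}, {b, c}, {c, d}, {d, a}} \<subseteq> N" unfolding eq[symmetric] by blast
  show ?thesis
  proof (cases "{a, b} \<in> M")
    case True
    have 1: "{b, c} \<in> N" using True alt(1) by simp
    have 2: "{c, d} \<in> M" using 1 one[of "{b, c}"] one[of "{c, d}"] alt(2) by simp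
    have 3: "{a, d} \<in> N" using 2 alt(3) by (simp add: insert_commute)
    have "M - {{a, b}, {c, d}} \<subseteq> N" using kept 1 3 by (auto simp: insert_commute)
    then show ?thesis using True 1 2 3 dist unfolding flip_def by blast
  next
    case False
    have 1: "{b, c} \<in> M" using False alt(1) one[of "{b, c}"] by simp
    have 2: "{c, d} \<in> N" using 1 alt(2) by simp
    have 3: "{d, a} \<in> M" using 2 one[of "{c, d}"] one[of "{d, a}"] alt(3) by simp
    have 4: "{b, a} \<in> N" using 3 alt(4) by (simp add: insert_commute)
    have "M - {{b, c}, {d, a}} \<subseteq> N" using kept 2 4 by (auto simp: insert_commute)
    moreover have "distinct [b, c, d, a]" using dist by auto
    ultimately show ?thesis using 1 2 3 4 unfolding flip_def by blast
  qed
qed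

lemma flip_image:
  assumes "inj_on f V" "\<Union>M \<subseteq> V" "flip M N"
  shows "flip ((`) f ` M) ((`) f ` N)"
proof -
  obtain a b c d where abcd: "distinct [a, b, c, d]" "{a, b} \<in> M" "{c, d} \<in> M"
      "{a, d} \<in> N" "{b, c} \<in> N" "M - {{a, b}, {c, d}} \<subseteq> N"
    using assms(3) unfolding flip_def by blast
  have "{a, b, c, d} \<subseteq> V" using abcd(2,3) assms(2) by blast
  then have "inj_on f {a, b, c, d}" by (rule inj_on_subset[OF assms(1)])
  then have "distinct [f a, f b, f c, f d]" using abcd(1) by (auto simp: inj_on_def)
  moreover have "{f a, f b} \<in> (`) f ` M" "{f c, f d} \<in> (`) f ` M"
    "{f a, f d} \<in> (`) f ` N" "{f b, f c} \<in> (`) f ` N"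
    using abcd(2-5)[THEN imageI, of "(`) f"] by simp_all
  moreover have "(`) f ` M - {{f a, f b}, {f c, f d}} \<subseteq> (`) f ` N"
  proof
    fix e assume e: "e \<in> (`) f ` M - {{f a, f b}, {f c, f d}}"
    then obtain e0 where "e0 \<in> M" "e = f ` e0" by blast
    moreover from this have "e0 \<noteq> {a, b}" "e0 \<noteq> {c, d}" using e by auto
    ultimately show "e \<in> (`) f ` N" using abcd(6) by blast
  qed
  ultimately show ?thesis unfolding flip_def by blast
qed

theorem proposition3p7:
  fixes n :: nat
  assumes "n \<ge> 3"
  shows "chromatic_number (flip_graph (complete_graph (2 * n)))
           \<le> chromatic_number (signed_reversal_graph (n - 1))
             + chromatic_number (signed_reversal_graph (n - 2))"
proof -
  let ?k = "chromatic_number (signed_reversal_graph (n - 1))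
             + chromatic_number (signed_reversal_graph (n - 2))"
  have "n > 0" using assms by simp
  then obtain col where col: "\<And>M. signed_matching n M \<Longrightarrow> col M < ?k"
      "\<And>M N. signed_matching n M \<Longrightarrow> signed_matching n N \<Longrightarrow> flip M N \<Longrightarrow> col M \<noteq> (col N :: nat)"
    using signed_matchings_colouring by blast
  have "col ((`) signed_label ` M) \<noteq> col ((`) signed_label ` N)"
    if M: "perfect_matching (complete_graph (2 * n)) M"
      and N: "perfect_matching (complete_graph (2 * n)) N"
      and "is_four_cycle (sym_diff M N)" for M N
  proof -
    have "\<Union>M \<subseteq> {1..2 * n}" using complete_graph_edgeE[OF M] by blast
    then have "flip ((`) signed_label ` M) ((`) signed_label ` N)"
      using flip_image[OF bij_betw_imp_inj_on[OF bij_betw_signed_label]] four_cycle_flip[OF that]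
      by blast
    then show ?thesis using col(2) signed_matching_image M N by blast
  qed
  then have "proper_colouring (flip_graph (complete_graph (2 * n))) ?k
      (\<lambda>M. col ((`) signed_label ` M))"
    unfolding proper_colouring_def flip_graph_def using col(1) signed_matching_image by auto
  then show ?thesis unfolding chromatic_number_def[of "flip_graph _"] by (intro Least_le exI)
qed

end
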